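(* Suppose that for every $(x,b)\in\mathcal X\times\mathcal B$ there exist a control input $u\in\mathcal U$ and a variable $\rho\in\mathbb R$ such that $$\text{(i)}\quad \sum_{\eta\in\mathcal H} c_\eta\,\nabla s_\eta^\top F(x,b,u)+\bar c\,\bigl(L-k_\tau-|\mathcal H|\bigr)\,\rho\ \ge\ -\gamma h_b(x,b),$$ $$\text{(ii)}\quad \nabla s_\mu^\top F(x,b,u)\ \ge\ \rho\qquad\text{for all }\mu\in\mathcal T,$$ where $\mathcal H,\mathcal T,c_\eta,\bar c,\nabla s_\eta,\nabla s_\mu$ are all evaluated at $(x,b)$. Then any controller with values in $\mathcal U$ that satisfies (i) and (ii) (for some $\rho$) at every $(x,b)\in\mathcal X\times\mathcal B$ renders the set $\mathcal C_b=\{(x,b)\in\mathcal X\times\mathcal B: h_b(x,b)\ge 0\}$ forward invariant under the continuous prediction dynamics $(\dot x,\dot b)=F(x,b,u)$.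
   Context: Robot dynamics: $\dot x=f(x)+g(x)u$ with state $x\in\mathcal X\subseteq\mathbb R^{n_x}$, input $u\in\mathcal U\subseteq\mathbb R^{n_u}$, $f:\mathbb R^{n_x}\to\mathbb R^{n_x}$, $g:\mathbb R^{n_x}\to\mathbb R^{n_x\times n_u}$. Object dynamics: $\dot o=\xi(o)$ with $o\in\mathcal O\subseteq\mathbb R^{n_o}$, $\xi:\mathbb R^{n_o}\to\mathbb R^{n_o}$. The belief state is $b=(\tilde o^{(1)},\dots,\tilde o^{(L)})\in\mathcal B\subseteq\mathbb R^{L n_o}$, a collection of $L$ particles $\tilde o^{(i)}\in\mathcal O$, all having the same constant weight $w>0$. The joint dynamics are $$F(x,b,u)=\begin{bmatrix} f(x)+g(x)u\\ \Xi(b)\end{bmatrix},\qquad \Xi(b)=\bigl(\xi(\tilde o^{(1)}),\dots,\xi(\tilde o^{(L)})\bigr).$$ Let $h_o:\mathbb R^{n_x}\times\mathbb R^{n_o}\to\mathbb R$ be smooth (single-object safety function) and $s_i(x,b)=h_o(x,\tilde o^{(i)})$, $i=1,\dots,L$; $\nabla s_i$ is the gradient with respect to $(x,b)$. Let $\tau\in(0,1)$ be the risk level and $$k_\tau=\min\Bigl\{L,\Bigl\lfloor\tfrac1w\ln\tfrac1{1-\tau}\Bigr\rfloor\Bigr\},$$ with $k_\tau<L$. Let $s_{(1)}\le\dots\le s_{(L)}$ be the order statistics of $s_1,\dots,s_L$ (at a given $(x,b)$). Let $\mathcal I^\star\subseteq\{1,\dots,L\}$ be any index set of cardinality $L-k_\tau$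 indexing the top $L-k_\tau$ values $s_{(k_\tau+1)},\dots,s_{(L)}$. For fixed $\kappa>0$ define the belief control barrier function $$h_b(x,b)=-\frac1\kappa\ln\Bigl(\sum_{i\in\mathcal I^\star}e^{-\kappa s_i(x,b)}\Bigr)$$ (its value does not depend on the choice of $\mathcal I^\star$). Define $\mathcal H=\{\eta: s_\eta>s_{(k_\tau+1)}\}$ and $\mathcal T=\{\mu: s_\mu=s_{(k_\tau+1)}\}$, both depending on $(x,b)$. The possible sets $\mathcal I^\star$ are exactly $\mathcal H\cup\mathcal J$ with $\mathcal J\subseteq\mathcal T$, $|\mathcal J|=L-k_\tau-|\mathcal H|$. Put $c_i=e^{-\kappa s_i}/\sum_{\ell\in\mathcal I^\star}e^{-\kappa s_\ell}$ for $i\in\mathcal I^\star$ (the denominator does not depend on the choice of $\mathcal I^\star$), and let $\bar c=e^{-\kappa s_{(k_\tau+1)}}/\sum_{\ell\in\mathcal I^\star}e^{-\kappa s_\ell}$ be the common value of $c_\mu$ for tied indices $\mu\in\mathcal T$. $\gamma>0$ is a constant. Forward invariance of $\mathcal C_b$: every closed-loop solution (absolutely continuous curve in $\mathcal X\times\mathcal B$ satisfying the differential equation for almost every time) starting in $\mathcal C_b$ at time $0$ remains in $\mathcal C_b$ for all times $t\ge0$ of the prediction phase. *)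

theory Defs
  imports "HOL-Analysis.Analysis" "HOL-Library.Multiset"
begin

primrec C_order :: "nat \<Rightarrow> ('a::euclidean_space \<Rightarrow> 'b::euclidean_space) \<Rightarrow> bool" where
  "C_order 0 \<phi> \<longleftrightarrow> continuous_on UNIV \<phi>"
| "C_order (Suc n) \<phi> \<longleftrightarrow>
     (\<forall>x. \<phi> differentiable (at x)) \<and> (\<forall>v. C_order n (\<lambda>x. frechet_derivative \<phi> (at x) v))"

definition smooth :: "('a::euclidean_space \<Rightarrow> 'b::euclidean_space) \<Rightarrow> bool" where
  "smooth \<phi> \<longleftrightarrow> (\<forall>n. C_order n \<phi>)"

definition gradient :: "('a::euclidean_space \<Rightarrow> real) \<Rightarrow> 'a \<Rightarrow> 'a" where
  "gradient \<phi> z = (THE D. GDERIV \<phi> z :> D)"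

text \<open>Absolute continuity, tested on finite families of non-overlapping subintervals,
  represented as pairs of endpoints.\<close>

definition absolutely_continuous_on :: "real set \<Rightarrow> (real \<Rightarrow> 'a::real_normed_vector) \<Rightarrow> bool" where
  "absolutely_continuous_on S z \<longleftrightarrow>
     (\<forall>\<epsilon>>0. \<exists>\<delta>>0. \<forall>D. finite D \<and> (\<forall>(a, b)\<in>D. a \<le> b \<and> {a..b} \<subseteq> S) \<and>
        pairwise (\<lambda>p q. {fst p<..<snd p} \<inter> {fst q<..<snd q} = {}) D \<and>
        (\<Sum>(a, b)\<in>D. b - a) < \<delta> \<longrightarrow> (\<Sum>(a, b)\<in>D. norm (z b - z a)) < \<epsilon>)"

text \<open>A joint state is a pair \<open>(x, b)\<close> of a robot state and a belief state; the belief consists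
  of particles indexed by the finite type \<open>'l\<close>, so that \<open>L = CARD('l)\<close>.\<close>

type_synonym ('nx, 'no, 'l) joint_state = "(real^'nx) \<times> ((real^'no)^'l)"

fun joint_dynamics ::
  "(real^'nx \<Rightarrow> real^'nx) \<Rightarrow> (real^'nx \<Rightarrow> real^'nu^'nx) \<Rightarrow> (real^'no \<Rightarrow> real^'no) \<Rightarrow>
   ('nx::finite, 'no::finite, 'l::finite) joint_state \<Rightarrow> real^'nu::finite \<Rightarrow>
   ('nx, 'no, 'l) joint_state" where
  "joint_dynamics f g \<xi> (x, b) u = (f x + g x *v u, (\<chi> i. \<xi> (b $ i)))"

text \<open>The times of the prediction phase form an arbitrary interval \<open>J\<close> with left end point \<open>0\<close>
  (bounded or not, closed or not); absolute continuity is required on the compact subintervals.\<close>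

definition closed_loop_solution ::
  "('s \<Rightarrow> 'u \<Rightarrow> 's) \<Rightarrow> ('s \<Rightarrow> 'u) \<Rightarrow> 's set \<Rightarrow> real set \<Rightarrow> (real \<Rightarrow> 's::real_normed_vector) \<Rightarrow> bool" where
  "closed_loop_solution F ctrl S J z \<longleftrightarrow>
     is_interval J \<and> 0 \<in> J \<and> J \<subseteq> {0..} \<and> z ` J \<subseteq> S \<and>
     (\<forall>c d. {c..d} \<subseteq> J \<longrightarrow> absolutely_continuous_on {c..d} z) \<and>
     (AE t in lebesgue. t \<in> J \<longrightarrow> (z has_vector_derivative F (z t) (ctrl (z t))) (at t within J))"

definition forward_invariant ::
  "('s \<Rightarrow> 'u \<Rightarrow> 's) \<Rightarrow> ('s \<Rightarrow> 'u) \<Rightarrow> 's set \<Rightarrow> ('s::real_normed_vector) set \<Rightarrow> bool" where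
  "forward_invariant F ctrl S C \<longleftrightarrow>
     (\<forall>J z. closed_loop_solution F ctrl S J z \<and> z 0 \<in> C \<longrightarrow> (\<forall>t\<in>J. z t \<in> C))"

definition risk_index :: "nat \<Rightarrow> real \<Rightarrow> real \<Rightarrow> nat" where
  "risk_index L w \<tau> = min L (nat \<lfloor>(1 / w) * ln (1 / (1 - \<tau>))\<rfloor>)"

fun particle_safety ::
  "((real^'nx) \<times> (real^'no) \<Rightarrow> real) \<Rightarrow> 'l \<Rightarrow> ('nx::finite, 'no::finite, 'l::finite) joint_state \<Rightarrow> real" where
  "particle_safety h\<^sub>o i (x, b) = h\<^sub>o (x, b $ i)"

text \<open>The \<open>j\<close>-th smallest value of the family \<open>v\<close>, counted with multiplicity from \<open>j = 1\<close>.\<close>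

definition order_stat :: "('i::finite \<Rightarrow> real) \<Rightarrow> nat \<Rightarrow> real" where
  "order_stat v j = sorted_list_of_multiset (image_mset v (mset_set UNIV)) ! (j - 1)"

definition top_index_set :: "nat \<Rightarrow> ('i::finite \<Rightarrow> real) \<Rightarrow> 'i set \<Rightarrow> bool" where
  "top_index_set k v I \<longleftrightarrow> card I = CARD('i) - k \<and>
     image_mset v (mset_set I) = image_mset (order_stat v) (mset_set {k + 1..CARD('i)})"

definition strict_top :: "nat \<Rightarrow> ('i::finite \<Rightarrow> real) \<Rightarrow> 'i set" where
  "strict_top k v = {\<eta>. v \<eta> > order_stat v (k + 1)}"

definition tied :: "nat \<Rightarrow> ('i::finite \<Rightarrow> real) \<Rightarrow> 'i set" where
  "tied k v = {\<mu>. v \<mu> = order_stat v (k + 1)}"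

definition exp_sum :: "real \<Rightarrow> ('i::finite \<Rightarrow> real) \<Rightarrow> 'i set \<Rightarrow> real" where
  "exp_sum \<kappa> v I = (\<Sum>i\<in>I. exp (- \<kappa> * v i))"

text \<open>In the next two definitions \<open>Istar\<close> is a choice, at every joint state, of an index set
  \<open>I\<close> with \<open>top_index_set k (\<lambda>i. particle_safety h\<^sub>o i z) I\<close>.\<close>

definition belief_cbf ::
  "((real^'nx) \<times> (real^'no) \<Rightarrow> real) \<Rightarrow> real \<Rightarrow>
   (('nx::finite, 'no::finite, 'l::finite) joint_state \<Rightarrow> 'l set) \<Rightarrow>
   ('nx, 'no, 'l) joint_state \<Rightarrow> real" where
  "belief_cbf h\<^sub>o \<kappa> Istar z =
     - (1 / \<kappa>) * ln (exp_sum \<kappa> (\<lambda>i. particle_safety h\<^sub>o i z) (Istar z))"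

definition cbf_constraints ::
  "((real^'nx) \<times> (real^'no) \<Rightarrow> real) \<Rightarrow> real \<Rightarrow> real \<Rightarrow> nat \<Rightarrow>
   (('nx::finite, 'no::finite, 'l::finite) joint_state \<Rightarrow> 'l set) \<Rightarrow>
   (('nx, 'no, 'l) joint_state \<Rightarrow> 'u \<Rightarrow> ('nx, 'no, 'l) joint_state) \<Rightarrow>
   ('nx, 'no, 'l) joint_state \<Rightarrow> 'u \<Rightarrow> real \<Rightarrow> bool" where
  "cbf_constraints h\<^sub>o \<kappa> \<gamma> k Istar F z u \<rho> \<longleftrightarrow>
     (let v = (\<lambda>i. particle_safety h\<^sub>o i z);
          H = strict_top k v;
          c = (\<lambda>i. exp (- \<kappa> * v i) / exp_sum \<kappa> v (Istar z));
          cbar = exp (- \<kappa> * order_stat v (k + 1)) / exp_sum \<kappa> v (Istar z)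
      in (\<Sum>\<eta>\<in>H. c \<eta> * (gradient (particle_safety h\<^sub>o \<eta>) z \<bullet> F z u))
            + cbar * (real CARD('l) - real k - real (card H)) * \<rho>
          \<ge> - \<gamma> * belief_cbf h\<^sub>o \<kappa> Istar z
       \<and> (\<forall>\<mu>\<in>tied k v. gradient (particle_safety h\<^sub>o \<mu>) z \<bullet> F z u \<ge> \<rho>))"

end

theory Submission
  imports Defs
begin

text \<open>The set where \<open>h\<^sub>b \<ge> 0\<close> is the sublevel set \<open>E \<le> 1\<close> of
  \<open>E = \<Sum>\<^sub>i exp (- \<kappa> s\<^sub>i)\<close>, \<open>i \<in> \<I>\<^sup>\<star>\<close>, and \<open>E\<close> is the minimum of the smooth functions
  \<open>S\<^sub>I = \<Sum>\<^sub>i exp (- \<kappa> s\<^sub>i)\<close>, \<open>i \<in> I\<close>, over all index sets of cardinality \<open>L - k\<close>. At almost every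
  time, (i) and (ii) give \<open>S\<^sub>I' \<le> - \<gamma> E ln E\<close> for every \<open>I\<close> attaining the minimum; where
  \<open>E > 1\<close> this is negative, and since near that time only such \<open>I\<close> can attain the minimum,
  \<open>E\<close> decreases locally. Along a solution \<open>E\<close> is absolutely continuous, so it cannot rise above 1
  after the last time at which \<open>E \<le> 1\<close>.\<close>

section \<open>Absolutely continuous functions on a real interval\<close>

lemma absolutely_continuous_onE:
  assumes "absolutely_continuous_on S z" "e > 0"
  obtains d where "d > 0" and
    "\<And>D. finite D \<Longrightarrow> (\<And>a b. (a, b) \<in> D \<Longrightarrow> a \<le> b \<and> {a..b} \<subseteq> S) \<Longrightarrow>
      pairwise (\<lambda>p q. {fst p<..<snd p} \<inter> {fst q<..<snd q} = {}) D \<Longrightarrow>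
      (\<Sum>(a, b)\<in>D. b - a) < d \<Longrightarrow> (\<Sum>(a, b)\<in>D. norm (z b - z a)) < e"
proof -
  obtain d where "d > 0" and d: "\<forall>D. finite D \<and> (\<forall>(a, b)\<in>D. a \<le> b \<and> {a..b} \<subseteq> S) \<and>
        pairwise (\<lambda>p q. {fst p<..<snd p} \<inter> {fst q<..<snd q} = {}) D \<and>
        (\<Sum>(a, b)\<in>D. b - a) < d \<longrightarrow> (\<Sum>(a, b)\<in>D. norm (z b - z a)) < e"
    using assms unfolding absolutely_continuous_on_def by blast
  show thesis
    by (rule that[OF \<open>d > 0\<close>], rule d[rule_format]) blast
qed

text \<open>The sums of increments of \<open>\<phi>\<close> are at most a constant times those of
  \<open>z\<close>, so the \<open>\<delta>\<close> of \<open>z\<close> for a proportionally smaller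
  tolerance works. This carries absolute continuity from a solution to a function of the state that
  is Lipschitz only along the trajectory.\<close>

lemma absolutely_continuous_on_dominated:
  assumes "absolutely_continuous_on S z"
    and "\<And>u v. u \<in> S \<Longrightarrow> v \<in> S \<Longrightarrow> norm (\<phi> v - \<phi> u) \<le> C * norm (z v - z u)"
  shows "absolutely_continuous_on S \<phi>"
  unfolding absolutely_continuous_on_def
proof (intro allI impI)
  fix e :: real assume "e > 0"
  \<comment> \<open>The sign of \<open>C\<close> is unrestricted, and the tolerance has to be
    divided by something positive.\<close>
  define C' where "C' = \<bar>C\<bar> + 1"
  have C': "C' > 0" "C \<le> C'" by (auto simp: C'_def)
  have "e / C' > 0" using \<open>e > 0\<close> C' by simp
  with assms(1) obtain d where "d > 0" and d:
    "\<And>D. finite D \<Longrightarrow> (\<And>a b. (a, b) \<in> D \<Longrightarrow> a \<le> b \<and> {a..b} \<subseteq> S) \<Longrightarrow>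
      pairwise (\<lambda>p q. {fst p<..<snd p} \<inter> {fst q<..<snd q} = {}) D \<Longrightarrow>
      (\<Sum>(a, b)\<in>D. b - a) < d \<Longrightarrow> (\<Sum>(a, b)\<in>D. norm (z b - z a)) < e / C'"
    by (rule absolutely_continuous_onE) blast
  show "\<exists>\<delta>>0. \<forall>D. finite D \<and> (\<forall>(a, b)\<in>D. a \<le> b \<and> {a..b} \<subseteq> S) \<and>
        pairwise (\<lambda>p q. {fst p<..<snd p} \<inter> {fst q<..<snd q} = {}) D \<and>
        (\<Sum>(a, b)\<in>D. b - a) < \<delta> \<longrightarrow> (\<Sum>(a, b)\<in>D. norm (\<phi> b - \<phi> a)) < e"
  proof (intro exI[of _ d] conjI allI impI \<open>d > 0\<close>, elim conjE)
    fix D assume D: "finite D" "\<forall>(a, b)\<in>D. a \<le> b \<and> {a..b} \<subseteq> S"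
      "pairwise (\<lambda>p q. {fst p<..<snd p} \<inter> {fst q<..<snd q} = {}) D"
      "(\<Sum>(a, b)\<in>D. b - a) < d"
    have "(\<Sum>(a, b)\<in>D. norm (\<phi> b - \<phi> a)) \<le> (\<Sum>(a, b)\<in>D. C' * norm (z b - z a))"
    proof (rule sum_mono, clarify)
      fix a b assume "(a, b) \<in> D"
      then have "a \<in> S" "b \<in> S" using D by fastforce+
      then have "norm (\<phi> b - \<phi> a) \<le> C * norm (z b - z a)" by (rule assms(2))
      also have "\<dots> \<le> C' * norm (z b - z a)" using C' by (intro mult_right_mono) auto
      finally show "norm (\<phi> b - \<phi> a) \<le> C' * norm (z b - z a)" .
    qed
    also have "\<dots> = C' * (\<Sum>(a, b)\<in>D. norm (z b - z a))"
      by (simp add: sum_distrib_left case_prod_beta)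
    also have "\<dots> < e" using d[of D] D C' by (auto simp: field_simps)
    finally show "(\<Sum>(a, b)\<in>D. norm (\<phi> b - \<phi> a)) < e" .
  qed
qed

text \<open>Families with a single interval already give continuity; \<open>S\<close> being an
  interval puts the segment between two of its points inside \<open>S\<close>.\<close>

lemma absolutely_continuous_on_imp_continuous_on:
  assumes "absolutely_continuous_on S z" and S: "is_interval S"
  shows "continuous_on S z"
  unfolding continuous_on_iff
proof (intro ballI allI impI)
  fix x and e :: real assume "x \<in> S" "e > 0"
  obtain d where "d > 0" and d:
    "\<And>D. finite D \<Longrightarrow> (\<And>a b. (a, b) \<in> D \<Longrightarrow> a \<le> b \<and> {a..b} \<subseteq> S) \<Longrightarrow>
      pairwise (\<lambda>p q. {fst p<..<snd p} \<inter> {fst q<..<snd q} = {}) D \<Longrightarrow>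
      (\<Sum>(a, b)\<in>D. b - a) < d \<Longrightarrow> (\<Sum>(a, b)\<in>D. norm (z b - z a)) < e"
    using assms(1) \<open>e > 0\<close> by (rule absolutely_continuous_onE) blast
  have *: "norm (z v - z u) < e" if "u \<in> S" "v \<in> S" "u \<le> v" "v - u < d" for u v
  proof -
    have "{u..v} \<subseteq> S"
      using mem_is_interval_1_I[OF S that(1,2)] by auto
    then show ?thesis using d[of "{(u, v)}"] that by simp
  qed
  have "dist (z y) (z x) < e" if "y \<in> S" "dist y x < d" for y
    using *[of x y] *[of y x] that \<open>x \<in> S\<close>
    by (cases "x \<le> y") (auto simp: dist_norm norm_minus_commute)
  then show "\<exists>d>0. \<forall>y\<in>S. dist y x < d \<longrightarrow> dist (z y) (z x) < e"
    using \<open>d > 0\<close> by blast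
qed

text \<open>A Cousin partition whose exceptional intervals lie in an open set of small measure
  replaces the usual passage through the Lebesgue integral of the derivative.\<close>

lemma absolutely_continuous_on_locally_decreasing:
  fixes \<phi> :: "real \<Rightarrow> real"
  assumes ac: "absolutely_continuous_on {a..b} \<phi>" and "a \<le> b" and "negligible N"
    and locally_decreasing: "\<And>t. t \<in> {a..b} - N \<Longrightarrow>
      \<exists>d>0. \<forall>u\<in>{a..b}. \<forall>v\<in>{a..b}. t - d < u \<and> u \<le> t \<and> t \<le> v \<and> v < t + d \<longrightarrow> \<phi> v \<le> \<phi> u"
  shows "\<phi> b \<le> \<phi> a"
proof (rule field_le_epsilon)
  fix e :: real assume "e > 0"
  with ac obtain \<delta> where "\<delta> > 0" and \<delta>:
    "\<And>D. finite D \<Longrightarrow> (\<And>u v. (u, v) \<in> D \<Longrightarrow> u \<le> v \<and> {u..v} \<subseteq> {a..b}) \<Longrightarrow>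
      pairwise (\<lambda>p q. {fst p<..<snd p} \<inter> {fst q<..<snd q} = {}) D \<Longrightarrow>
      (\<Sum>(u, v)\<in>D. v - u) < \<delta> \<Longrightarrow> (\<Sum>(u, v)\<in>D. norm (\<phi> v - \<phi> u)) < e"
    by (rule absolutely_continuous_onE) blast
  have N: "N \<in> null_sets lebesgue"
    using \<open>negligible N\<close> by (simp add: negligible_iff_null_sets)
  \<comment> \<open>Outer regularity bounds the measure of \<open>T - N\<close>; since
    \<open>N\<close> is null, the bound passes to \<open>T\<close> itself.\<close>
  then obtain T where T: "open T" "N \<subseteq> T" and TN: "T - N \<in> lmeasurable" "emeasure lebesgue (T - N) < ennreal \<delta>"
    using sets_lebesgue_outer_open[of N \<delta>] \<open>\<delta> > 0\<close> by (metis null_setsD2)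
  have "T = (T - N) \<union> N" using T by blast
  then have T_meas: "T \<in> lmeasurable"
    by (metis TN(1) N \<open>negligible N\<close> fmeasurable.Un negligible_imp_measurable)
  have "measure lebesgue T = measure lebesgue (T - N)"
    using N T_meas by (simp add: measure_Diff_null_set fmeasurableD)
  also have "\<dots> < \<delta>"
    using TN \<open>\<delta> > 0\<close> by (simp add: emeasure_eq_measure2 ennreal_less_iff)
  finally have T_small: "measure lebesgue T < \<delta>" .
  \<comment> \<open>The gauge has two tasks: around a tag in \<open>N\<close> it stays inside
    \<open>T\<close>, and around a tag of \<open>{a..b}\<close> outside \<open>N\<close> it stays
    within the range of the local decrease.\<close>
  have "\<exists>d>0. (t \<in> N \<longrightarrow> ball t d \<subseteq> T) \<and> (t \<in> {a..b} - N \<longrightarrow>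
      (\<forall>u\<in>{a..b}. \<forall>v\<in>{a..b}. t - d < u \<and> u \<le> t \<and> t \<le> v \<and> v < t + d \<longrightarrow> \<phi> v \<le> \<phi> u))" for t
  proof (cases "t \<in> N")
    case True
    then show ?thesis using T open_contains_ball[of T] by blast
  next
    case False
    then show ?thesis
      using locally_decreasing[of t] by (cases "t \<in> {a..b}") (auto intro: exI[of _ "1::real"])
  qed
  then obtain d where d: "\<And>t. d t > 0" "\<And>t. t \<in> N \<Longrightarrow> ball t (d t) \<subseteq> T"
    "\<And>t u v. t \<in> {a..b} - N \<Longrightarrow> u \<in> {a..b} \<Longrightarrow> v \<in> {a..b} \<Longrightarrow>
      t - d t < u \<Longrightarrow> u \<le> t \<Longrightarrow> t \<le> v \<Longrightarrow> v < t + d t \<Longrightarrow> \<phi> v \<le> \<phi> u"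
    by metis
  have "gauge (\<lambda>t. ball t (d t))" using d(1) by (intro gauge_ball_dependent) auto
  then obtain p where p: "p tagged_division_of {a..b}" and fine: "(\<lambda>t. ball t (d t)) fine p"
    by (rule fine_division_exists_real)
  note pD = tagged_division_ofD[OF p]
  have K: "\<exists>u v. u \<le> x \<and> x \<le> v \<and> K = {u..v} \<and> u \<in> {a..b} \<and> v \<in> {a..b} \<and> {u..v} \<subseteq> ball x (d x)"
    if xK: "(x, K) \<in> p" for x K
  proof -
    obtain u v where "K = {u..v}" using pD(4)[OF xK] by auto
    moreover have "K \<subseteq> ball x (d x)" using fine xK by (auto simp: fine_def)
    ultimately show ?thesis using pD(2,3)[OF xK]
      by (intro exI[of _ u] exI[of _ v]) auto
  qed
  \<comment> \<open>The part of the partition with exceptional tags; its total length will be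
    controlled by the measure of \<open>T\<close>.\<close>
  define q where "q = {(x, K) \<in> p. x \<in> N}"
  have "q \<subseteq> p" "finite p" "finite q" using pD(1) by (auto simp: q_def intro: finite_subset)
  have q: "q tagged_division_of \<Union>(snd ` q)"
    using \<open>q \<subseteq> p\<close> p by (meson tagged_division_of_def tagged_partial_division_of_Union_self
        tagged_partial_division_subset)
  then have div: "snd ` q division_of \<Union>(snd ` q)" by (rule division_of_tagged_division)
  \<comment> \<open>\<open>Sup\<close> and \<open>Inf\<close> of the empty set are unspecified, so
    the value 0 is set by hand; then \<open>\<omega>\<close> vanishes on every interval with empty
    interior.\<close>
  define \<omega> where "\<omega> = (\<lambda>K. if K = {} then 0 else norm (\<phi> (Sup K) - \<phi> (Inf K)))"
  define D where "D = (\<lambda>K::real set. (Inf K, Sup K)) ` snd ` q"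
  have qK: "\<exists>u v. u \<le> v \<and> K = {u..v} \<and> {u..v} \<subseteq> {a..b}" if Kq: "K \<in> snd ` q" for K
  proof -
    obtain x where "(x, K) \<in> p" using Kq \<open>q \<subseteq> p\<close> by auto
    from K[OF this] pD(3)[OF this] show ?thesis by fastforce
  qed
  have inj: "inj_on (\<lambda>K::real set. (Inf K, Sup K)) (snd ` q)"
  proof (rule inj_onI)
    fix K K' assume "K \<in> snd ` q" "K' \<in> snd ` q" and eq: "(Inf K, Sup K) = (Inf K', Sup K')"
    then obtain u v u' v' where "u \<le> v" "K = {u..v}" "u' \<le> v'" "K' = {u'..v'}"
      by (meson qK)
    then show "K = K'" using eq by simp
  qed
  have "(\<Sum>(u, v)\<in>D. norm (\<phi> v - \<phi> u)) < e"
  proof (rule \<delta>)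
    show "finite D" using \<open>finite q\<close> by (simp add: D_def)
    fix u v assume "(u, v) \<in> D"
    then obtain K where "K \<in> snd ` q" "u = Inf K" "v = Sup K" by (auto simp: D_def)
    then show "u \<le> v \<and> {u..v} \<subseteq> {a..b}" using qK[of K] by auto
  next
    show "pairwise (\<lambda>p q. {fst p<..<snd p} \<inter> {fst q<..<snd q} = {}) D"
      unfolding D_def
    proof (rule pairwise_imageI)
      fix K K' assume KK': "K \<in> snd ` q" "K' \<in> snd ` q" "K \<noteq> K'"
      then obtain u v u' v' where *: "u \<le> v" "K = {u..v}" "u' \<le> v'" "K' = {u'..v'}"
        by (meson qK)
      have "interior K \<inter> interior K' = {}" using division_ofD(5)[OF div] KK' by blast
      then show "{fst (Inf K, Sup K)<..<snd (Inf K, Sup K)} \<inter> {fst (Inf K', Sup K')<..<snd (Inf K', Sup K')} = {}"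
        using * by simp
    qed
    \<comment> \<open>The lengths add up to the measure of the union, and the gauge keeps that union
      inside \<open>T\<close>.\<close>
    have "(\<Sum>(u, v)\<in>D. v - u) = (\<Sum>K\<in>snd ` q. Sup K - Inf K)"
      unfolding D_def by (subst sum.reindex[OF inj]) simp
    also have "\<dots> = (\<Sum>K\<in>snd ` q. measure lebesgue K)"
    proof (rule sum.cong[OF refl])
      fix K assume "K \<in> snd ` q"
      then obtain u v where "u \<le> v" "K = {u..v}" by (meson qK)
      then show "Sup K - Inf K = measure lebesgue K" by simp
    qed
    also have "\<dots> = measure lebesgue (\<Union>(snd ` q))" by (rule content_division[OF div])
    also have "\<dots> \<le> measure lebesgue T"
    proof (rule measure_mono_fmeasurable[OF _ _ T_meas])
      show "\<Union>(snd ` q) \<subseteq> T"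
      proof clarsimp
        fix x K y assume xK: "(x, K) \<in> q" "y \<in> K"
        then have "x \<in> N" "K \<subseteq> ball x (d x)" using K[of x K] by (auto simp: q_def)
        then show "y \<in> T" using d(2) xK by blast
      qed
      show "\<Union>(snd ` q) \<in> sets lebesgue"
        using lmeasurable_division[OF div] by auto
    qed
    also note T_small
    finally show "(\<Sum>(u, v)\<in>D. v - u) < \<delta>" .
  qed
  moreover have "(\<Sum>(u, v)\<in>D. norm (\<phi> v - \<phi> u)) = (\<Sum>K\<in>snd ` q. \<omega> K)"
    unfolding D_def
    by (subst sum.reindex[OF inj]) (use qK in \<open>fastforce simp: \<omega>_def intro!: sum.cong\<close>)
  \<comment> \<open>A degenerate interval may occur with several tags, so \<open>snd\<close> need
    not be injective on \<open>q\<close>; such repetitions contribute 0.\<close>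
  moreover have "(\<Sum>K\<in>snd ` q. \<omega> K) = (\<Sum>(x, K)\<in>q. \<omega> K)"
    by (rule sum.over_tagged_division_lemma[OF q, symmetric]) (auto simp: \<omega>_def box_real)
  moreover have "(\<Sum>(x, K)\<in>q. \<phi> (Sup K) - \<phi> (Inf K)) \<le> (\<Sum>(x, K)\<in>q. \<omega> K)"
  proof (rule sum_mono, clarify)
    fix x K assume "(x, K) \<in> q"
    then have "K \<noteq> {}" using pD(2) \<open>q \<subseteq> p\<close> by blast
    then show "\<phi> (Sup K) - \<phi> (Inf K) \<le> \<omega> K" by (simp add: \<omega>_def)
  qed
  ultimately have exceptional: "(\<Sum>(x, K)\<in>q. \<phi> (Sup K) - \<phi> (Inf K)) \<le> e" by linarith
  \<comment> \<open>The tag lies between the endpoints of its interval, so the local decrease at the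
    tag compares the two endpoints directly.\<close>
  have regular: "(\<Sum>(x, K)\<in>p - q. \<phi> (Sup K) - \<phi> (Inf K)) \<le> 0"
  proof (rule sum_nonpos, clarify)
    fix x K assume xK: "(x, K) \<in> p" "(x, K) \<notin> q"
    obtain u v where uv: "u \<le> x" "x \<le> v" "K = {u..v}" "u \<in> {a..b}" "v \<in> {a..b}" "{u..v} \<subseteq> ball x (d x)"
      using K[OF xK(1)] by blast
    have "u \<in> {u..v}" "v \<in> {u..v}" using uv(1,2) by auto
    then have "u \<in> ball x (d x)" "v \<in> ball x (d x)" using uv(6) by blast+
    then have "\<phi> v \<le> \<phi> u"
      using uv xK by (intro d(3)[of x]) (auto simp: q_def dist_real_def)
    then show "\<phi> (Sup K) - \<phi> (Inf K) \<le> 0" using uv by simp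
  qed
  have "\<phi> b - \<phi> a = (\<Sum>(x, K)\<in>p. \<phi> (Sup K) - \<phi> (Inf K))"
    by (rule additive_tagged_division_1[OF \<open>a \<le> b\<close> p, symmetric])
  also have "\<dots> = (\<Sum>(x, K)\<in>p - q. \<phi> (Sup K) - \<phi> (Inf K)) + (\<Sum>(x, K)\<in>q. \<phi> (Sup K) - \<phi> (Inf K))"
    by (rule sum.subset_diff[OF \<open>q \<subseteq> p\<close> \<open>finite p\<close>])
  finally show "\<phi> b \<le> \<phi> a + e" using exceptional regular by linarith
qed

section \<open>Order statistics and the choices of the top index set\<close>

lemma size_filter_image_mset_set:
  assumes "finite A"
  shows "size (filter_mset P (image_mset \<phi> (mset_set A))) = card {a \<in> A. P (\<phi> a)}"
  using assms by (simp add: filter_mset_image_mset)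

lemma length_order_stat_list:
  "length (sorted_list_of_multiset (image_mset v (mset_set (UNIV :: 'i::finite set)))) = CARD('i)"
  by (simp flip: size_mset)

lemma order_stat_mono:
  fixes v :: "'i::finite \<Rightarrow> real"
  assumes "1 \<le> j" "j \<le> j'" "j' \<le> CARD('i)"
  shows "order_stat v j \<le> order_stat v j'"
  unfolding order_stat_def
  using assms by (intro sorted_nth_mono) (auto simp: length_order_stat_list)

text \<open>The order statistics list the values of \<open>v\<close> with multiplicity, so a
  property of values holds for as many ranks as indices. Statements about ranks thereby become
  cardinalities of index sets.\<close>

lemma card_order_stat:
  fixes v :: "'i::finite \<Rightarrow> real"
  shows "card {j \<in> {1..CARD('i)}. P (order_stat v j)} = card {i. P (v i)}"
proof -
  let ?xs = "sorted_list_of_multiset (image_mset v (mset_set UNIV))"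
  have "card {i. P (v i)} = size (filter_mset P (mset ?xs))"
    by (simp add: size_filter_image_mset_set)
  also have "\<dots> = length (filter P ?xs)"
    by (metis mset_filter size_mset)
  also have "\<dots> = card {j. j < CARD('i) \<and> P (?xs ! j)}"
    by (simp add: length_filter_conv_card length_order_stat_list)
  \<comment> \<open>List positions start at 0, ranks at 1.\<close>
  also have "\<dots> = card (Suc ` {j. j < CARD('i) \<and> P (?xs ! j)})"
    by (simp add: card_image)
  also have "Suc ` {j. j < CARD('i) \<and> P (?xs ! j)} = {j \<in> {1..CARD('i)}. P (order_stat v j)}"
  proof -
    have "j \<in> Suc ` {j. j < CARD('i) \<and> P (?xs ! j)}" if "j \<in> {1..CARD('i)}" "P (order_stat v j)" for j
      using that by (intro image_eqI[of _ _ "j - 1"]) (auto simp: order_stat_def)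
    then show ?thesis by (auto simp: order_stat_def)
  qed
  finally show ?thesis by simp
qed

text \<open>The sets satisfying this closed condition are the possible choices of \<open>\<I>\<^sup>\<star>\<close>;
  unlike \<^const>\<open>top_index_set\<close> it visibly passes to limits of \<open>v\<close>.\<close>

definition dominating :: "('i \<Rightarrow> real) \<Rightarrow> 'i set \<Rightarrow> bool" where
  "dominating v I \<longleftrightarrow> (\<forall>i\<in>I. \<forall>j. j \<notin> I \<longrightarrow> v j \<le> v i)"

text \<open>Every value on \<open>I\<close> is at least the order statistic \<open>?q\<close> of
  rank \<open>k + 1\<close>. Counting shows that \<open>I\<close> contains as many indices with
  value above \<open>?q\<close> as there are altogether, hence all of them; so the values outside
  \<open>I\<close> are at most \<open>?q\<close>.\<close>

lemma top_index_set_imp_dominating: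
  fixes v :: "'i::finite \<Rightarrow> real"
  assumes I: "top_index_set k v I" and "k < CARD('i)"
  shows "dominating v I"
proof -
  let ?q = "order_stat v (k + 1)"
  have img: "image_mset v (mset_set I) = image_mset (order_stat v) (mset_set {k + 1..CARD('i)})"
    using I by (simp add: top_index_set_def)
  have ge: "?q \<le> v i" if "i \<in> I" for i
  proof -
    have "v i \<in># image_mset v (mset_set I)" using that by simp
    then have "v i \<in> order_stat v ` {k + 1..CARD('i)}" unfolding img by simp
    then show ?thesis by (auto intro!: order_stat_mono)
  qed
  have "card {i \<in> I. v i > ?q} = size (filter_mset (\<lambda>y. y > ?q) (image_mset v (mset_set I)))"
    by (simp add: size_filter_image_mset_set)
  also have "\<dots> = card {j \<in> {k + 1..CARD('i)}. order_stat v j > ?q}"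
    unfolding img by (rule size_filter_image_mset_set) simp
  \<comment> \<open>Ranks up to \<open>k\<close> cannot exceed \<open>?q\<close> by monotonicity, so
    the restriction to ranks from \<open>k + 1\<close> on loses nothing.\<close>
  also have "{j \<in> {k + 1..CARD('i)}. order_stat v j > ?q} = {j \<in> {1..CARD('i)}. order_stat v j > ?q}"
  proof -
    have "k + 1 \<le> j" if "j \<in> {1..CARD('i)}" "order_stat v j > ?q" for j
      using that order_stat_mono[of j "k + 1" v] \<open>k < CARD('i)\<close> by fastforce
    then show ?thesis by auto
  qed
  also have "card \<dots> = card {i. v i > ?q}" by (rule card_order_stat)
  finally have "{i \<in> I. v i > ?q} = {i. v i > ?q}"
    by (intro card_subset_eq) auto
  then have "v j \<le> ?q" if "j \<notin> I" for j
    using that by (metis (mono_tags, lifting) mem_Collect_eq not_le)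
  then show ?thesis using ge by (force simp: dominating_def)
qed

text \<open>Fewer than \<open>card I\<close> indices lie above \<open>?q\<close>, and at least
  \<open>card I\<close> lie at or above it. Hence a dominating set of this size can neither omit an
  index above \<open>?q\<close> nor contain one below it.\<close>

lemma dominating_strict_top_tied:
  fixes v :: "'i::finite \<Rightarrow> real"
  assumes card_I: "card I = CARD('i) - k" and k: "k < CARD('i)" and I: "dominating v I"
  shows "strict_top k v \<subseteq> I" and "I - strict_top k v \<subseteq> tied k v"
proof -
  let ?q = "order_stat v (k + 1)"
  have "{j \<in> {1..CARD('i)}. order_stat v j > ?q} \<subseteq> {k + 2..CARD('i)}"
  proof clarsimp
    fix j assume "Suc 0 \<le> j" "j \<le> CARD('i)" "order_stat v (Suc k) < order_stat v j"
    then show "Suc (Suc k) \<le> j"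
      using order_stat_mono[of j "k + 1" v] k by fastforce
  qed
  then have "card {i. v i > ?q} \<le> card {k + 2..CARD('i)}"
    unfolding card_order_stat[of "\<lambda>y. y > ?q" v, symmetric] by (rule card_mono[rotated]) simp
  then have gt: "card {i. v i > ?q} < card I" using card_I k by simp
  have "{k + 1..CARD('i)} \<subseteq> {j \<in> {1..CARD('i)}. order_stat v j \<ge> ?q}"
    by (auto intro!: order_stat_mono)
  then have "card {k + 1..CARD('i)} \<le> card {i. v i \<ge> ?q}"
    unfolding card_order_stat[of "\<lambda>y. y \<ge> ?q" v, symmetric] by (rule card_mono[rotated]) simp
  then have ge: "card I \<le> card {i. v i \<ge> ?q}" using card_I k by simp
  show "strict_top k v \<subseteq> I"
  proof
    fix j assume j: "j \<in> strict_top k v"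
    show "j \<in> I"
    proof (rule ccontr)
      assume "j \<notin> I"
      then have "I \<subseteq> {i. v i > ?q}" using I j by (force simp: dominating_def strict_top_def)
      then have "card I \<le> card {i. v i > ?q}" by (rule card_mono[rotated]) simp
      then show False using gt by simp
    qed
  qed
  show "I - strict_top k v \<subseteq> tied k v"
  proof (clarify, rule ccontr)
    fix i assume i: "i \<in> I" "i \<notin> strict_top k v" "i \<notin> tied k v"
    then have "v i < ?q" by (simp add: strict_top_def tied_def)
    then have "{i. v i \<ge> ?q} \<subseteq> I - {i}" using I i by (force simp: dominating_def)
    then have "card {i. v i \<ge> ?q} \<le> card (I - {i})" by (rule card_mono[rotated]) simp
    also have "\<dots> < card I" using i(1) by (intro card_Diff1_less) auto
    finally show False using ge by simp
  qed
qed

text \<open>An exchange argument: a bijection from \<open>I - I'\<close> to \<open>I' - I\<close>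
  replaces each value by one that is no larger, which can only increase the exponentials. So
  dominating sets minimize the sum among sets of equal cardinality.\<close>

lemma dominating_exp_sum_le:
  fixes v :: "'i::finite \<Rightarrow> real"
  assumes I: "dominating v I" and card_eq: "card I = card I'" and "\<kappa> > 0"
  shows "exp_sum \<kappa> v I \<le> exp_sum \<kappa> v I'"
proof -
  have "card (I - I') = card (I' - I)"
    using card_eq card_Int_Diff[of I I'] card_Int_Diff[of I' I] by (simp add: Int_commute)
  then obtain \<pi> where \<pi>: "bij_betw \<pi> (I - I') (I' - I)"
    by (metis finite finite_same_card_bij)
  have "(\<Sum>i\<in>I - I'. exp (- \<kappa> * v i)) \<le> (\<Sum>i\<in>I - I'. exp (- \<kappa> * v (\<pi> i)))"
  proof (rule sum_mono)
    fix i assume "i \<in> I - I'"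
    then have "v (\<pi> i) \<le> v i"
      using I bij_betwE[OF \<pi>] by (auto simp: dominating_def)
    then show "exp (- \<kappa> * v i) \<le> exp (- \<kappa> * v (\<pi> i))" using \<open>\<kappa> > 0\<close> by simp
  qed
  also have "\<dots> = (\<Sum>i\<in>I' - I. exp (- \<kappa> * v i))"
    by (rule sum.reindex_bij_betw[OF \<pi>])
  finally have "(\<Sum>i\<in>I - I'. exp (- \<kappa> * v i)) \<le> (\<Sum>i\<in>I' - I. exp (- \<kappa> * v i))" .
  moreover have "exp_sum \<kappa> v I = (\<Sum>i\<in>I \<inter> I'. exp (- \<kappa> * v i)) + (\<Sum>i\<in>I - I'. exp (- \<kappa> * v i))"
    unfolding exp_sum_def by (rule sum.Int_Diff) simp
  moreover have "exp_sum \<kappa> v I' = (\<Sum>i\<in>I \<inter> I'. exp (- \<kappa> * v i)) + (\<Sum>i\<in>I' - I. exp (- \<kappa> * v i))"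
    unfolding exp_sum_def by (subst Int_commute, rule sum.Int_Diff) simp
  ultimately show ?thesis by linarith
qed

section \<open>From the two constraints to a derivative bound for every active sum\<close>

lemma exp_sum_pos:
  fixes v :: "'i::finite \<Rightarrow> real"
  assumes "I \<noteq> {}"
  shows "exp_sum \<kappa> v I > 0"
  unfolding exp_sum_def using assms by (intro sum_pos) auto

text \<open>Multiplication by \<open>E\<close> clears the denominators in (i). The factor of
  \<open>\<rho>\<close> counts the tied indices used by \<open>I\<close>, so (ii) replaces each copy
  of \<open>\<rho>\<close> by a derivative, whichever tied indices \<open>I\<close> contains. The
  left side is \<open>- 1 / \<kappa>\<close> times the derivative of the sum over
  \<open>I\<close>.\<close>

lemma cbf_constraints_imp_active_sum_ge:
  fixes z :: "('nx::finite, 'no::finite, 'l::finite) joint_state"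
    and h\<^sub>o :: "(real^'nx) \<times> (real^'no) \<Rightarrow> real"
  defines "v \<equiv> \<lambda>i. particle_safety h\<^sub>o i z"
  assumes cbf: "cbf_constraints h\<^sub>o \<kappa> \<gamma> k Istar F z u \<rho>" and "k < CARD('l)" "\<kappa> > 0"
    and Istar: "top_index_set k v (Istar z)"
    and I: "dominating v I" "card I = CARD('l) - k"
  shows "(\<Sum>i\<in>I. exp (- \<kappa> * v i) * (gradient (particle_safety h\<^sub>o i) z \<bullet> F z u))
           \<ge> \<gamma> / \<kappa> * (exp_sum \<kappa> v (Istar z) * ln (exp_sum \<kappa> v (Istar z)))"
proof -
  let ?E = "exp_sum \<kappa> v (Istar z)" and ?H = "strict_top k v" and ?q = "order_stat v (k + 1)"
  let ?d = "\<lambda>i. gradient (particle_safety h\<^sub>o i) z \<bullet> F z u"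
  have "Istar z \<noteq> {}" using Istar \<open>k < CARD('l)\<close> by (auto simp: top_index_set_def)
  then have "?E > 0" by (rule exp_sum_pos)
  note HI = dominating_strict_top_tied[OF I(2) \<open>k < CARD('l)\<close> I(1)]
  have tied: "?d \<mu> \<ge> \<rho>" if "\<mu> \<in> tied k v" for \<mu>
    using cbf that unfolding cbf_constraints_def v_def Let_def by blast
  have "- \<gamma> * belief_cbf h\<^sub>o \<kappa> Istar z \<le> (\<Sum>\<eta>\<in>?H. exp (- \<kappa> * v \<eta>) / ?E * ?d \<eta>) +
      exp (- \<kappa> * ?q) / ?E * (real CARD('l) - real k - real (card ?H)) * \<rho>"
    using cbf unfolding cbf_constraints_def v_def Let_def by blast
  also have "\<dots> = ((\<Sum>\<eta>\<in>?H. exp (- \<kappa> * v \<eta>) * ?d \<eta>) +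
      exp (- \<kappa> * ?q) * (real CARD('l) - real k - real (card ?H)) * \<rho>) / ?E"
    by (simp add: add_divide_distrib sum_divide_distrib)
  finally have "?E * (- \<gamma> * belief_cbf h\<^sub>o \<kappa> Istar z) \<le> (\<Sum>\<eta>\<in>?H. exp (- \<kappa> * v \<eta>) * ?d \<eta>) +
      exp (- \<kappa> * ?q) * (real CARD('l) - real k - real (card ?H)) * \<rho>"
    using \<open>?E > 0\<close> by (simp add: field_simps)
  \<comment> \<open>The constraint speaks only of cardinalities; here they become the tied part of
    the given \<open>I\<close>.\<close>
  also have "real CARD('l) - real k - real (card ?H) = real (card (I - ?H))"
    using HI(1) I(2) \<open>k < CARD('l)\<close> card_mono[OF _ HI(1)]
    by (simp add: card_Diff_subset of_nat_diff)
  also have "exp (- \<kappa> * ?q) * real (card (I - ?H)) * \<rho> = (\<Sum>\<mu>\<in>I - ?H. exp (- \<kappa> * ?q) * \<rho>)"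
    by simp
  also have "\<dots> \<le> (\<Sum>\<mu>\<in>I - ?H. exp (- \<kappa> * v \<mu>) * ?d \<mu>)"
  proof (rule sum_mono)
    fix \<mu> assume "\<mu> \<in> I - ?H"
    then have "\<mu> \<in> tied k v" using HI by blast
    then show "exp (- \<kappa> * ?q) * \<rho> \<le> exp (- \<kappa> * v \<mu>) * ?d \<mu>"
      using tied by (simp add: tied_def)
  qed
  also have "(\<Sum>\<eta>\<in>?H. exp (- \<kappa> * v \<eta>) * ?d \<eta>) + (\<Sum>\<mu>\<in>I - ?H. exp (- \<kappa> * v \<mu>) * ?d \<mu>) =
      (\<Sum>i\<in>I. exp (- \<kappa> * v i) * ?d i)"
    using sum.subset_diff[OF HI(1), of "\<lambda>i. exp (- \<kappa> * v i) * ?d i"] by simp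
  finally show ?thesis by (simp add: belief_cbf_def v_def algebra_simps)
qed

section \<open>Differentiability and Lipschitz bounds\<close>

text \<open>A bounded set lies in a closed ball, which is compact and convex. Compactness bounds
  each directional derivative along the basis, these bound the operator norm, and convexity permits
  the mean value inequality.\<close>

lemma bounded_imp_lipschitz_on_C1:
  fixes \<phi> :: "'a::euclidean_space \<Rightarrow> 'b::real_normed_vector"
  assumes der: "\<And>x. (\<phi> has_derivative \<phi>' x) (at x)"
    and cont: "\<And>v. continuous_on UNIV (\<lambda>x. \<phi>' x v)"
    and "bounded S"
  obtains C where "C \<ge> 0" "\<And>x y. x \<in> S \<Longrightarrow> y \<in> S \<Longrightarrow> norm (\<phi> x - \<phi> y) \<le> C * norm (x - y)"
proof -
  obtain r where "\<And>x. x \<in> S \<Longrightarrow> norm x \<le> r" using \<open>bounded S\<close> unfolding bounded_iff by blast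
  then have r: "S \<subseteq> cball 0 r" by auto
  have "\<exists>M\<ge>0. \<forall>x\<in>cball 0 r. norm (\<phi>' x i) \<le> M" for i
  proof -
    have "compact ((\<lambda>x. \<phi>' x i) ` cball 0 r)"
      by (intro compact_continuous_image continuous_on_subset[OF cont]) auto
    then obtain M where "\<forall>y\<in>(\<lambda>x. \<phi>' x i) ` cball 0 r. norm y \<le> M"
      using compact_imp_bounded bounded_iff by metis
    then show ?thesis by (intro exI[of _ "\<bar>M\<bar>"]) force
  qed
  then obtain M where M: "\<And>i. M i \<ge> 0" "\<And>x i. x \<in> cball 0 r \<Longrightarrow> norm (\<phi>' x i) \<le> M i" by metis
  define C where "C = (\<Sum>i\<in>Basis. M i)"
  have onorm: "onorm (\<phi>' x) \<le> C" if "x \<in> cball 0 r" for x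
  proof (rule onorm_le)
    fix h
    have lin: "linear (\<phi>' x)" using der has_derivative_linear by blast
    have "\<phi>' x h = \<phi>' x (\<Sum>i\<in>Basis. (h \<bullet> i) *\<^sub>R i)" by (simp add: euclidean_representation)
    also have "\<dots> = (\<Sum>i\<in>Basis. (h \<bullet> i) *\<^sub>R \<phi>' x i)"
      by (simp add: linear_sum[OF lin] linear_scale[OF lin])
    also have "norm \<dots> \<le> (\<Sum>i\<in>Basis. norm h * M i)"
      using M that by (intro sum_norm_le) (simp add: Basis_le_norm mult_mono)
    finally show "norm (\<phi>' x h) \<le> C * norm h"
      by (simp add: C_def sum_distrib_right mult.commute[of "norm h"])
  qed
  have "norm (\<phi> x - \<phi> y) \<le> C * norm (x - y)" if "x \<in> S" "y \<in> S" for x y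
    using that r der onorm
    by (intro differentiable_bound[OF convex_cball, of 0 r \<phi> \<phi>'])
       (auto intro: has_derivative_at_withinI)
  moreover have "C \<ge> 0" using M by (auto simp: C_def intro: sum_nonneg)
  ultimately show ?thesis using that by blast
qed

lemma smooth_has_derivative:
  assumes "smooth \<phi>"
  shows "(\<phi> has_derivative frechet_derivative \<phi> (at x)) (at x)"
    and "continuous_on UNIV (\<lambda>x. frechet_derivative \<phi> (at x) h)"
proof -
  have "C_order (Suc 0) \<phi>" using assms by (simp only: smooth_def)
  then show "(\<phi> has_derivative frechet_derivative \<phi> (at x)) (at x)"
    and "continuous_on UNIV (\<lambda>x. frechet_derivative \<phi> (at x) h)"
    by (auto simp: frechet_derivative_works)
qed

text \<open>\<open>gradient\<close> is a definite description, so both existence and uniqueness are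
  required: the vector \<open>D\<close> with coordinates \<open>\<phi>' i\<close> represents
  \<open>\<phi>'\<close>, and derivatives are unique.\<close>

lemma has_derivative_gradient:
  fixes \<phi> :: "'a::euclidean_space \<Rightarrow> real"
  assumes "(\<phi> has_derivative \<phi>') (at x)"
  shows "(\<phi> has_derivative (\<lambda>h. gradient \<phi> x \<bullet> h)) (at x)"
proof -
  have lin: "linear \<phi>'" using assms has_derivative_linear by blast
  define D where "D = (\<Sum>i\<in>Basis. \<phi>' i *\<^sub>R i)"
  have rep: "\<phi>' = (\<lambda>h. h \<bullet> D)"
  proof
    fix h
    have "\<phi>' h = \<phi>' (\<Sum>i\<in>Basis. (h \<bullet> i) *\<^sub>R i)" by (simp add: euclidean_representation)
    also have "\<dots> = h \<bullet> D"
      by (simp add: D_def linear_sum[OF lin] linear_scale[OF lin] inner_sum_right mult.commute)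
    finally show "\<phi>' h = h \<bullet> D" .
  qed
  have D: "GDERIV \<phi> x :> D"
    using assms unfolding gderiv_def rep .
  have "D' = D" if "GDERIV \<phi> x :> D'" for D'
  proof -
    have "(\<lambda>h. h \<bullet> D') = (\<lambda>h. h \<bullet> D)"
      using that D unfolding gderiv_def by (rule has_derivative_unique)
    then have "\<forall>h. h \<bullet> D' = h \<bullet> D" by (rule fun_cong[THEN allI])
    then show ?thesis by (rule vector_eq_ldot[THEN iffD1])
  qed
  with D have "gradient \<phi> x = D" unfolding gradient_def by (rule the_equality)
  moreover have "(\<lambda>h. h \<bullet> D) = (\<lambda>h. D \<bullet> h)" by (rule ext) (rule inner_commute)
  ultimately show ?thesis using D unfolding gderiv_def by (simp only:)
qed

lemma particle_safety_eq: "particle_safety h\<^sub>o i = (\<lambda>z. h\<^sub>o (fst z, snd z $ i))"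
  by (simp add: fun_eq_iff)

text \<open>The chain rule through the linear map selecting the robot state and particle
  \<open>i\<close>. In this explicit form, continuity of the derivative in \<open>z\<close> follows
  from smoothness of \<open>h\<^sub>o\<close>.\<close>

lemma has_derivative_particle_safety:
  assumes "smooth h\<^sub>o"
  shows "(particle_safety h\<^sub>o i has_derivative
      (\<lambda>y. frechet_derivative h\<^sub>o (at (fst z, snd z $ i)) (fst y, snd y $ i))) (at z)"
proof -
  have "bounded_linear (\<lambda>y. (fst y, snd y $ i))"
    by (intro bounded_linear_Pair bounded_linear_fst
        bounded_linear_compose[OF bounded_linear_vec_nth bounded_linear_snd])
  from has_derivative_compose[OF bounded_linear_imp_has_derivative[OF this, of "at z"]
      smooth_has_derivative(1)[OF assms]]
  show ?thesis unfolding particle_safety_eq .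
qed

lemma particle_safety_has_real_derivative:
  assumes "smooth h\<^sub>o" and z: "(z has_vector_derivative z') (at t within S)"
  shows "((\<lambda>t. particle_safety h\<^sub>o i (z t)) has_real_derivative
      gradient (particle_safety h\<^sub>o i) (z t) \<bullet> z') (at t within S)"
proof -
  have "(particle_safety h\<^sub>o i has_derivative (\<lambda>y. gradient (particle_safety h\<^sub>o i) (z t) \<bullet> y)) (at (z t))"
    by (rule has_derivative_gradient[OF has_derivative_particle_safety[OF assms(1)]])
  from has_derivative_compose[OF z[unfolded has_vector_derivative_def] this]
  show ?thesis by (simp add: has_field_derivative_def mult_commute_abs)
qed

lemma exp_particle_safety_lipschitz_on_bounded:
  fixes S :: "('nx::finite, 'no::finite, 'l::finite) joint_state set"
    and h\<^sub>o :: "(real^'nx) \<times> (real^'no) \<Rightarrow> real"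
  assumes h: "smooth h\<^sub>o" and "bounded S"
  obtains C where "C \<ge> 0"
    "\<And>x y. x \<in> S \<Longrightarrow> y \<in> S \<Longrightarrow>
      norm (exp (- \<kappa> * particle_safety h\<^sub>o i x) - exp (- \<kappa> * particle_safety h\<^sub>o i y)) \<le> C * norm (x - y)"
proof (rule bounded_imp_lipschitz_on_C1[OF _ _ \<open>bounded S\<close>])
  let ?d = "\<lambda>z y. frechet_derivative h\<^sub>o (at (fst z, snd z $ i)) (fst y, snd y $ i)"
  show "((\<lambda>z. exp (- \<kappa> * particle_safety h\<^sub>o i z)) has_derivative
      (\<lambda>y. exp (- \<kappa> * particle_safety h\<^sub>o i z) * (- \<kappa> * ?d z y))) (at z)" for z :: "('nx, 'no, 'l) joint_state"
    by (rule derivative_eq_intros has_derivative_particle_safety[OF h] refl)+ (simp add: algebra_simps)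
  have "continuous_on UNIV (particle_safety h\<^sub>o i :: ('nx, 'no, 'l) joint_state \<Rightarrow> real)"
    by (intro continuous_at_imp_continuous_on ballI has_derivative_continuous[OF has_derivative_particle_safety[OF h]])
  moreover have "continuous_on UNIV (\<lambda>z::('nx, 'no, 'l) joint_state. ?d z y)" for y :: "('nx, 'no, 'l) joint_state"
    by (rule continuous_on_compose2[OF smooth_has_derivative(2)[OF h]]) (auto intro!: continuous_intros)
  ultimately show "continuous_on UNIV (\<lambda>z. exp (- \<kappa> * particle_safety h\<^sub>o i z) * (- \<kappa> * ?d z y))"
    for y :: "('nx, 'no, 'l) joint_state"
    by (intro continuous_intros)
qed blast

text \<open>The chosen set may jump with the state, but a minimum of finitely many Lipschitz
  functions is Lipschitz. Summing the constants of all particles makes the bound independent of the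
  index set.\<close>

lemma exp_sum_Istar_lipschitz_on_bounded:
  fixes S :: "('nx::finite, 'no::finite, 'l::finite) joint_state set"
    and h\<^sub>o :: "(real^'nx) \<times> (real^'no) \<Rightarrow> real"
  assumes h: "smooth h\<^sub>o" and "bounded S" and "\<kappa> > 0" and "k < CARD('l)"
    and Istar: "\<And>z. top_index_set k (\<lambda>i. particle_safety h\<^sub>o i z) (Istar z)"
  obtains C where "\<And>x y. x \<in> S \<Longrightarrow> y \<in> S \<Longrightarrow>
      norm (exp_sum \<kappa> (\<lambda>i. particle_safety h\<^sub>o i x) (Istar x) -
        exp_sum \<kappa> (\<lambda>i. particle_safety h\<^sub>o i y) (Istar y)) \<le> C * norm (x - y)"
proof -
  let ?e = "\<lambda>i z. exp (- \<kappa> * particle_safety h\<^sub>o i z)"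
  let ?S = "\<lambda>I z. exp_sum \<kappa> (\<lambda>i. particle_safety h\<^sub>o i z) I"
  have "\<exists>C\<ge>0. \<forall>x\<in>S. \<forall>y\<in>S. norm (?e i x - ?e i y) \<le> C * norm (x - y)" for i
    using exp_particle_safety_lipschitz_on_bounded[OF h \<open>bounded S\<close>, of \<kappa> i] by metis
  then obtain C where C: "\<And>i. C i \<ge> 0"
      "\<And>i x y. x \<in> S \<Longrightarrow> y \<in> S \<Longrightarrow> norm (?e i x - ?e i y) \<le> C i * norm (x - y)"
    by metis
  have le: "?S (Istar x) x - ?S (Istar y) y \<le> sum C UNIV * norm (x - y)" if "x \<in> S" "y \<in> S" for x y
  proof -
    \<comment> \<open>Minimality at \<open>x\<close> allows the set chosen at \<open>y\<close>, so
      that both sums run over the same indices.\<close>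
    have "?S (Istar x) x \<le> ?S (Istar y) x"
      using Istar top_index_set_imp_dominating[OF Istar \<open>k < CARD('l)\<close>] \<open>\<kappa> > 0\<close>
      by (intro dominating_exp_sum_le) (auto simp: top_index_set_def)
    then have "?S (Istar x) x - ?S (Istar y) y \<le> (\<Sum>i\<in>Istar y. ?e i x - ?e i y)"
      by (simp add: exp_sum_def sum_subtractf)
    also have "\<dots> \<le> (\<Sum>i\<in>Istar y. C i * norm (x - y))"
      using C(2)[OF that] by (intro sum_mono) (metis abs_le_D1 real_norm_def)
    also have "\<dots> \<le> (\<Sum>i\<in>UNIV. C i * norm (x - y))"
      using C(1) by (intro sum_mono2) auto
    finally show ?thesis by (simp add: sum_distrib_right)
  qed
  have "norm (?S (Istar x) x - ?S (Istar y) y) \<le> sum C UNIV * norm (x - y)" if "x \<in> S" "y \<in> S" for x y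
    using le[OF that] le[OF that(2,1)] by (simp add: norm_minus_commute abs_le_iff)
  then show ?thesis by (rule that)
qed

section \<open>Local decrease along a solution\<close>

text \<open>Only the derivative at \<open>t\<close> is known, so values on the two sides of
  \<open>t\<close> are compared through \<open>E t\<close>, each by means of a fixed index set that
  is active at \<open>t\<close>.\<close>

lemma exp_sum_Istar_locally_decreasing:
  fixes z :: "real \<Rightarrow> ('nx::finite, 'no::finite, 'l::finite) joint_state"
    and h\<^sub>o :: "(real^'nx) \<times> (real^'no) \<Rightarrow> real"
    and \<kappa> :: real and Istar :: "('nx, 'no, 'l) joint_state \<Rightarrow> 'l set"
  defines "E \<equiv> \<lambda>t. exp_sum \<kappa> (\<lambda>i. particle_safety h\<^sub>o i (z t)) (Istar (z t))"
  assumes h: "smooth h\<^sub>o" and "\<kappa> > 0" "\<gamma> > 0" and k: "k < CARD('l)"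
    and Istar: "\<And>z. top_index_set k (\<lambda>i. particle_safety h\<^sub>o i z) (Istar z)"
    and z: "(z has_vector_derivative F (z t) u) (at t within T)" and "t \<in> T"
    and cbf: "cbf_constraints h\<^sub>o \<kappa> \<gamma> k Istar F (z t) u \<rho>"
    and "E t > 1"
  shows "\<exists>d>0. \<forall>r\<in>T. \<forall>s\<in>T. t - d < r \<and> r \<le> t \<and> t \<le> s \<and> s < t + d \<longrightarrow> E s \<le> E r"
proof -
  let ?v = "\<lambda>s i. particle_safety h\<^sub>o i (z s)"
  let ?S = "\<lambda>I s. exp_sum \<kappa> (?v s) I"
  let ?g = "\<lambda>i. gradient (particle_safety h\<^sub>o i) (z t) \<bullet> F (z t) u"
  have Istar_dom: "dominating (?v s) (Istar (z s))" "card (Istar (z s)) = CARD('l) - k" for s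
    using Istar[of "z s"] top_index_set_imp_dominating[OF Istar k] by (auto simp: top_index_set_def)
  have v_der: "((\<lambda>s. ?v s i) has_real_derivative ?g i) (at t within T)" for i
    by (rule particle_safety_has_real_derivative[OF h z])
  have v_tendsto: "((\<lambda>s. ?v s i) \<longlongrightarrow> ?v t i) (at t within T)" for i
    using DERIV_continuous[OF v_der] by (simp add: continuous_within)
  \<comment> \<open>A failure of domination is a strict inequality between two values and persists
    near \<open>t\<close>; so sets active near \<open>t\<close> are active at
    \<open>t\<close>.\<close>
  have dominating_ev: "\<forall>\<^sub>F s in at t within T. dominating (?v s) I \<longrightarrow> dominating (?v t) I" for I
  proof (cases "dominating (?v t) I")
    case False
    then obtain i j where ij: "i \<in> I" "j \<notin> I" "?v t i < ?v t j"
      by (auto simp: dominating_def not_le)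
    have "((\<lambda>s. ?v s j - ?v s i) \<longlongrightarrow> ?v t j - ?v t i) (at t within T)"
      by (intro tendsto_diff v_tendsto)
    then have "\<forall>\<^sub>F s in at t within T. ?v s j - ?v s i > 0"
      using ij(3) by (intro order_tendstoD) auto
    then show ?thesis
      by (rule eventually_mono) (use ij in \<open>force simp: dominating_def\<close>)
  qed simp
  have decreasing_ev: "\<forall>\<^sub>F s in at t within T. (s < t \<longrightarrow> ?S I t \<le> ?S I s) \<and> (t < s \<longrightarrow> ?S I s \<le> ?S I t)"
    if I: "dominating (?v t) I" "card I = CARD('l) - k" for I
  proof -
    \<comment> \<open>This is where \<open>E t > 1\<close> enters: it makes the derivative strictly
      negative, which a one-point derivative needs to yield local decrease.\<close>
    have "E t * ln (E t) > 0" using \<open>E t > 1\<close> by simp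
    then have "\<gamma> / \<kappa> * (E t * ln (E t)) > 0" using \<open>\<kappa> > 0\<close> \<open>\<gamma> > 0\<close> by simp
    also have "\<dots> \<le> (\<Sum>i\<in>I. exp (- \<kappa> * ?v t i) * ?g i)"
      unfolding E_def by (rule cbf_constraints_imp_active_sum_ge[OF cbf k \<open>\<kappa> > 0\<close> Istar I])
    finally have neg: "- \<kappa> * (\<Sum>i\<in>I. exp (- \<kappa> * ?v t i) * ?g i) < 0"
      using \<open>\<kappa> > 0\<close> by simp
    have "((?S I) has_real_derivative (- \<kappa> * (\<Sum>i\<in>I. exp (- \<kappa> * ?v t i) * ?g i))) (at t within T)"
      unfolding exp_sum_def
      by (rule derivative_eq_intros v_der refl)+ (simp add: sum_distrib_left algebra_simps)
    from has_real_derivative_neg_dec_left[OF this neg] has_real_derivative_neg_dec_right[OF this neg]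
    obtain d1 d2 where d: "d1 > 0" "\<And>h. h > 0 \<Longrightarrow> t - h \<in> T \<Longrightarrow> h < d1 \<Longrightarrow> ?S I t < ?S I (t - h)"
      "d2 > 0" "\<And>h. h > 0 \<Longrightarrow> t + h \<in> T \<Longrightarrow> h < d2 \<Longrightarrow> ?S I (t + h) < ?S I t"
      by metis
    show ?thesis
      unfolding eventually_at
    proof (intro exI[of _ "min d1 d2"] conjI ballI impI)
      fix s assume s: "s \<in> T" "s \<noteq> t \<and> dist s t < min d1 d2"
      show "?S I t \<le> ?S I s" if "s < t" using d(2)[of "t - s"] s that by (simp add: dist_real_def)
      show "?S I s \<le> ?S I t" if "t < s" using d(4)[of "s - t"] s that by (simp add: dist_real_def)
    qed (use d in auto)
  qed
  define P where "P s I \<longleftrightarrow> (dominating (?v s) I \<longrightarrow> dominating (?v t) I) \<and>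
      (dominating (?v t) I \<and> card I = CARD('l) - k \<longrightarrow>
        (s < t \<longrightarrow> ?S I t \<le> ?S I s) \<and> (t < s \<longrightarrow> ?S I s \<le> ?S I t))" for s I
  \<comment> \<open>There are finitely many index sets, hence one neighbourhood serves them
    all.\<close>
  have "\<forall>\<^sub>F s in at t within T. \<forall>I. P s I"
    unfolding P_def
  proof (intro eventually_all_finite eventually_conj dominating_ev)
    fix I
    show "\<forall>\<^sub>F s in at t within T. dominating (?v t) I \<and> card I = CARD('l) - k \<longrightarrow>
        (s < t \<longrightarrow> ?S I t \<le> ?S I s) \<and> (t < s \<longrightarrow> ?S I s \<le> ?S I t)"
    proof (cases "dominating (?v t) I \<and> card I = CARD('l) - k")
      case True
      then show ?thesis using decreasing_ev[of I] by simp
    next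
      case False
      then show ?thesis by (intro always_eventually) blast
    qed
  qed
  then obtain d where "d > 0" and d: "\<And>s I. s \<in> T \<Longrightarrow> s \<noteq> t \<Longrightarrow> dist s t < d \<Longrightarrow> P s I"
    unfolding eventually_at by blast
  \<comment> \<open>After \<open>t\<close>, the set chosen at \<open>t\<close> gives an upper bound
    for the minimum at \<open>s\<close> and decreases from \<open>E t\<close>.\<close>
  have after: "E s \<le> E t" if "s \<in> T" "t \<le> s" "s < t + d" for s
  proof (cases "s = t")
    case False
    have "E s \<le> ?S (Istar (z t)) s"
      unfolding E_def using Istar_dom \<open>\<kappa> > 0\<close> by (intro dominating_exp_sum_le) auto
    also have "\<dots> \<le> E t"
      using d[of s "Istar (z t)"] that False Istar_dom[of t] unfolding E_def P_def
      by (simp add: dist_real_def)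
    finally show ?thesis .
  qed simp
  \<comment> \<open>Before \<open>t\<close>, the set chosen at \<open>r\<close> is used instead; it
    is active at \<open>t\<close> as well, so its sum decreases from \<open>E r\<close> to a value
    at least \<open>E t\<close>.\<close>
  have before: "E t \<le> E r" if "r \<in> T" "r \<le> t" "t - d < r" for r
  proof (cases "r = t")
    case False
    have le: "?S (Istar (z r)) t \<le> E r"
      using d[of r "Istar (z r)"] that False Istar_dom[of r] unfolding E_def P_def
      by (simp add: dist_real_def)
    have "E t \<le> ?S (Istar (z r)) t"
      unfolding E_def using Istar_dom \<open>\<kappa> > 0\<close> by (intro dominating_exp_sum_le) auto
    then show ?thesis using le by linarith
  qed simp
  show ?thesis
  proof (intro exI[of _ d] conjI ballI impI \<open>d > 0\<close>)
    fix r s assume rs: "r \<in> T" "s \<in> T" "t - d < r \<and> r \<le> t \<and> t \<le> s \<and> s < t + d"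
    have "E s \<le> E t" using rs by (intro after) auto
    also have "E t \<le> E r" using rs by (intro before) auto
    finally show "E s \<le> E r" .
  qed
qed

section \<open>Forward invariance of the safe set\<close>

lemma belief_cbf_nonneg_iff:
  fixes z :: "('nx::finite, 'no::finite, 'l::finite) joint_state"
    and h\<^sub>o :: "(real^'nx) \<times> (real^'no) \<Rightarrow> real"
  assumes "\<kappa> > 0" "k < CARD('l)" "top_index_set k (\<lambda>i. particle_safety h\<^sub>o i z) (Istar z)"
  shows "belief_cbf h\<^sub>o \<kappa> Istar z \<ge> 0 \<longleftrightarrow> exp_sum \<kappa> (\<lambda>i. particle_safety h\<^sub>o i z) (Istar z) \<le> 1"
proof -
  have "Istar z \<noteq> {}" using assms by (auto simp: top_index_set_def)
  then have "exp_sum \<kappa> (\<lambda>i. particle_safety h\<^sub>o i z) (Istar z) > 0" by (rule exp_sum_pos)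
  then show ?thesis
    using \<open>\<kappa> > 0\<close> by (simp add: belief_cbf_def zero_le_divide_iff mult_le_0_iff divide_le_0_iff)
qed

theorem theorem1:
  fixes f :: "real^'nx::finite \<Rightarrow> real^'nx"
    and g :: "real^'nx \<Rightarrow> real^'nu::finite^'nx"
    and \<xi> :: "real^'no::finite \<Rightarrow> real^'no"
    and X :: "(real^'nx) set" and U :: "(real^'nu) set" and Obj :: "(real^'no) set"
    and B :: "((real^'no)^'l::finite) set"
    and h\<^sub>o :: "(real^'nx) \<times> (real^'no) \<Rightarrow> real"
    and w \<tau> \<kappa> \<gamma> :: real and k :: nat
    and Istar :: "('nx, 'no, 'l) joint_state \<Rightarrow> 'l set"
    and ctrl :: "('nx, 'no, 'l) joint_state \<Rightarrow> real^'nu"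
  assumes particles: "\<And>b i. b \<in> B \<Longrightarrow> b $ i \<in> Obj"
    and w: "w > 0" and tau: "0 < \<tau>" "\<tau> < 1" and kappa: "\<kappa> > 0" and gamma: "\<gamma> > 0"
    and k: "k = risk_index CARD('l) w \<tau>" and k_less: "k < CARD('l)"
    and smooth: "smooth h\<^sub>o"
    and Istar: "\<And>z. top_index_set k (\<lambda>i. particle_safety h\<^sub>o i z) (Istar z)"
    and feasible: "\<And>z. z \<in> X \<times> B \<Longrightarrow>
      \<exists>u\<in>U. \<exists>\<rho>. cbf_constraints h\<^sub>o \<kappa> \<gamma> k Istar (joint_dynamics f g \<xi>) z u \<rho>"
    and ctrl_values: "\<And>z. z \<in> X \<times> B \<Longrightarrow> ctrl z \<in> U"
    and ctrl_constraints: "\<And>z. z \<in> X \<times> B \<Longrightarrow>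
      \<exists>\<rho>. cbf_constraints h\<^sub>o \<kappa> \<gamma> k Istar (joint_dynamics f g \<xi>) z (ctrl z) \<rho>"
  shows "forward_invariant (joint_dynamics f g \<xi>) ctrl (X \<times> B)
           {z \<in> X \<times> B. belief_cbf h\<^sub>o \<kappa> Istar z \<ge> 0}"
  unfolding forward_invariant_def
proof (intro allI impI ballI)
  let ?F = "joint_dynamics f g \<xi>"
  fix J and z :: "real \<Rightarrow> ('nx, 'no, 'l) joint_state" and t
  assume sol: "closed_loop_solution ?F ctrl (X \<times> B) J z \<and> z 0 \<in> {z \<in> X \<times> B. 0 \<le> belief_cbf h\<^sub>o \<kappa> Istar z}"
    and "t \<in> J"
  define E where "E = (\<lambda>s. exp_sum \<kappa> (\<lambda>i. particle_safety h\<^sub>o i (z s)) (Istar (z s)))"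
  have safe_iff: "0 \<le> belief_cbf h\<^sub>o \<kappa> Istar (z s) \<longleftrightarrow> E s \<le> 1" for s
    unfolding E_def by (rule belief_cbf_nonneg_iff[OF kappa k_less Istar])
  have J: "is_interval J" "0 \<in> J" "J \<subseteq> {0..}" and zJ: "\<And>s. s \<in> J \<Longrightarrow> z s \<in> X \<times> B"
    and ac: "\<And>c d. {c..d} \<subseteq> J \<Longrightarrow> absolutely_continuous_on {c..d} z"
    and ae: "AE s in lebesgue. s \<in> J \<longrightarrow> (z has_vector_derivative ?F (z s) (ctrl (z s))) (at s within J)"
    using sol by (auto simp: closed_loop_solution_def)
  have "0 \<le> t" using J(3) \<open>t \<in> J\<close> by auto
  have sub: "{0..t} \<subseteq> J"
    using mem_is_interval_1_I[OF J(1,2) \<open>t \<in> J\<close>] by auto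
  have "continuous_on {0..t} z"
    by (intro absolutely_continuous_on_imp_continuous_on ac sub is_interval_cc)
  then have "compact (z ` {0..t})" by (intro compact_continuous_image) auto
  then have "bounded (z ` {0..t})" by (rule compact_imp_bounded)
  \<comment> \<open>The trajectory up to time \<open>t\<close> is compact, so one Lipschitz constant
    covers all states visited.\<close>
  then obtain C where C: "\<And>x y. x \<in> z ` {0..t} \<Longrightarrow> y \<in> z ` {0..t} \<Longrightarrow>
      norm (exp_sum \<kappa> (\<lambda>i. particle_safety h\<^sub>o i x) (Istar x) -
        exp_sum \<kappa> (\<lambda>i. particle_safety h\<^sub>o i y) (Istar y)) \<le> C * norm (x - y)"
    using exp_sum_Istar_lipschitz_on_bounded[OF smooth _ kappa k_less Istar] by blast
  have E_ac: "absolutely_continuous_on {c..t} E" if "0 \<le> c" for c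
  proof (rule absolutely_continuous_on_dominated)
    show "absolutely_continuous_on {c..t} z" using sub that by (intro ac) auto
    show "norm (E s - E r) \<le> C * norm (z s - z r)" if "r \<in> {c..t}" "s \<in> {c..t}" for r s
      unfolding E_def using that \<open>0 \<le> c\<close> by (intro C) auto
  qed
  have "E t \<le> 1"
  proof (rule ccontr)
    assume "\<not> E t \<le> 1"
    define A where "A = {s \<in> {0..t}. E s \<le> 1}"
    have "continuous_on {0..t} E"
      by (intro absolutely_continuous_on_imp_continuous_on E_ac is_interval_cc) simp
    then have "closed A" unfolding A_def by (intro continuous_on_closed_Collect_le) auto
    moreover have "bounded A" by (rule bounded_subset[of "{0..t}"]) (auto simp: A_def)
    ultimately have "compact A" by (simp add: compact_eq_bounded_closed)
    moreover have "0 \<in> A" using sol safe_iff \<open>0 \<le> t\<close> by (auto simp: A_def)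
    \<comment> \<open>The last safe time before \<open>t\<close>, attained because the safe times
      form a compact set containing 0.\<close>
    ultimately obtain a where a: "a \<in> A" "\<And>s. s \<in> A \<Longrightarrow> s \<le> a"
      using compact_attains_sup[of A] by blast
    then have "0 \<le> a" "a \<le> t" "E a \<le> 1" by (auto simp: A_def)
    have E_gt: "E s > 1" if "a < s" "s \<le> t" for s
    proof (rule ccontr)
      assume "\<not> E s > 1"
      then have "s \<in> A" using that \<open>0 \<le> a\<close> by (simp add: A_def)
      then show False using a(2) \<open>a < s\<close> by fastforce
    qed
    have "{a..t} \<subseteq> J" using sub \<open>0 \<le> a\<close> by auto
    define N where "N = {s. \<not> (s \<in> J \<longrightarrow> (z has_vector_derivative ?F (z s) (ctrl (z s))) (at s within J))}"
    obtain N' where "N' \<in> null_sets lebesgue" "N \<subseteq> N'"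
      using ae unfolding eventually_ae_filter N_def by auto
    then have "negligible N" using negligible_iff_null_sets negligible_subset by blast
    then have "negligible (insert a N)" by simp
    have "E t \<le> E a"
    proof (rule absolutely_continuous_on_locally_decreasing[OF E_ac[OF \<open>0 \<le> a\<close>] \<open>a \<le> t\<close> \<open>negligible (insert a N)\<close>])
      fix s assume s: "s \<in> {a..t} - insert a N"
      then have "s \<in> J" "a < s" "s \<le> t" "s \<notin> N" using \<open>{a..t} \<subseteq> J\<close> by auto
      then have "(z has_vector_derivative ?F (z s) (ctrl (z s))) (at s within J)"
        by (simp add: N_def)
      then have der: "(z has_vector_derivative ?F (z s) (ctrl (z s))) (at s within {a..t})"
        using \<open>{a..t} \<subseteq> J\<close> by (rule has_vector_derivative_within_subset)
      obtain \<rho> where cbf: "cbf_constraints h\<^sub>o \<kappa> \<gamma> k Istar ?F (z s) (ctrl (z s)) \<rho>"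
        using ctrl_constraints[OF zJ[OF \<open>s \<in> J\<close>]] by blast
      have "s \<in> {a..t}" using s by simp
      with exp_sum_Istar_locally_decreasing[where F = ?F and z = z and t = s and u = "ctrl (z s)",
          OF smooth kappa gamma k_less Istar der _ cbf]
      show "\<exists>d>0. \<forall>u\<in>{a..t}. \<forall>v\<in>{a..t}. s - d < u \<and> u \<le> s \<and> s \<le> v \<and> v < s + d \<longrightarrow> E v \<le> E u"
        using E_gt[OF \<open>a < s\<close> \<open>s \<le> t\<close>] unfolding E_def .
    qed
    then show False using \<open>\<not> E t \<le> 1\<close> \<open>E a \<le> 1\<close> by simp
  qed
  then show "z t \<in> {z \<in> X \<times> B. 0 \<le> belief_cbf h\<^sub>o \<kappa> Istar z}"
    using safe_iff zJ[OF \<open>t \<in> J\<close>] by simp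
qed

end
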